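(* Let $q:\mathbb R^n\to\Delta_{n-1}$ be a choice model derived from a differentiable choice welfare function $w$, i.e. $q=\nabla w$. Then: 1. $q$ is a substitutable choice model if and only if $w$ is submodular. 2. If $q$ is a substitutable choice model, then there exists an essentially strictly convex function $V$ with $\bar V_i$ supermodular on $\mathbb R^{n-1}$ for all $i\in\{1,\dots,n\}$, such that for all $\mu\in\mathbb R^n$ $$q(\mu)=\arg\max\{\mu^Tx-V(x)\mid x\in\Delta_{n-1}\},$$ where, for $z\in\mathbb R^{n-1}$, $$\bar V_i(z)=\begin{cases}V\big(z_1,\dots,z_{i-1},\,1-\sum_{j=1}^{n-1}z_j,\,z_i,\dots,z_{n-1}\big)&\text{if }\sum_{j=1}^{n-1}z_j\le1\text{ and }z\ge0,\\+\infty&\text{otherwise}\end{cases}$$ (the entry $1-\sum_j z_j$ being in the $i$th position). Furthermore, the reverse of item 2 is true if $n=3$: if $n=3$ and there exists an essentially strictly convex function $V$ with $\bar V_i$ supermodular on $\mathbb R^{2}$ for all $i$ such that $q(\mu)=\arg\max\{\mu^Tx-V(x)\mid x\in\Delta_{2}\}$ for all $\mu$, then $q$ is a substitutable choice model.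
   Context: $\Delta_{n-1}=\{x\in\mathbb R^n\mid\sum_i x_i=1,\ x\ge0\}$; $\mathbf e$ is the all-ones vector. A choice model is any function $q:\mathbb R^n\to\Delta_{n-1}$. A differentiable choice welfare function is a differentiable function $w:\mathbb R^n\to\mathbb R$ that is monotone ($\mu\ge\mu'$ componentwise implies $w(\mu)\ge w(\mu')$), translation invariant ($w(\mu+t\mathbf e)=w(\mu)+t$ for all $\mu\in\mathbb R^n$, $t\in\mathbb R$) and convex. A function $f:\mathbb R\to\mathbb R$ is locally decreasing at $x$ if there exists $\delta>0$ such that $f(x-h)\ge f(x)\ge f(x+h)$ for all $0<h<\delta$. Alternative $i$ is substitutable to alternative $j$ if for every $\mu\in\mathbb R^n$, $q_j$ is locally decreasing in $\mu_i$ at $\mu$ (other coordinates fixed). $q$ is a substitutable choice model if alternative $i$ is substitutable to alternative $j$ for all $i\ne j$. A function $f:\mathbb R^m\to\mathbb R\cup\{\infty\}$ is supermodular if $f(x\vee y)+f(x\wedge y)\ge f(x)+f(y)$ for all $x,y\in\mathbb R^m$, where $\vee,\wedge$ are componentwise maximum and minimum. $f:\mathbb R^m\to\mathbb R\cup\{-\infty\}$ is submodular if $-f$ is supermodular. A proper convex function $f$ on $\mathbb R^n$ (proper: $f<\infty$ somewhere and $f>-\infty$ everywhere) is essentially strictly convex if it is strictly convex on every convex subset of $\{x\mid\partial f(x)\neq\emptyset\}$, where $\partial f(x)$ is the set of subgradients of $f$ at $x$. A function given only on $\Delta_{n-1}$ is regarded as $+\infty$ outside $\Delta_{n-1}$.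 Regularization functions $V$ are assumed lower semicontinuous. The equation $q(\mu)=\arg\max\{\cdots\}$ means that the maximizer exists, is unique and equals $q(\mu)$. *)

theory Defs
  imports "HOL-Analysis.Analysis"
begin

(* The order, lattice and metric structure on real ^ 'n is the library's componentwise one. *)

definition prob_simplex :: "(real ^ 'n) set" where
  "prob_simplex = {x. (\<Sum>i\<in>UNIV. x $ i) = 1 \<and> (\<forall>i. 0 \<le> x $ i)}"

definition choice_model :: "(real ^ 'n \<Rightarrow> real ^ 'n) \<Rightarrow> bool" where
  "choice_model q \<longleftrightarrow> range q \<subseteq> prob_simplex"

definition diff_choice_welfare :: "(real ^ 'n \<Rightarrow> real) \<Rightarrow> bool" where
  "diff_choice_welfare w \<longleftrightarrow>
     (\<forall>\<mu>. w differentiable (at \<mu>)) \<and>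
     mono w \<and>
     (\<forall>\<mu> t. w (\<mu> + t *\<^sub>R vec 1) = w \<mu> + t) \<and>
     convex_on UNIV w"

definition locally_decreasing_at :: "(real \<Rightarrow> real) \<Rightarrow> real \<Rightarrow> bool" where
  "locally_decreasing_at f x \<longleftrightarrow>
     (\<exists>\<delta>>0. \<forall>h. 0 < h \<and> h < \<delta> \<longrightarrow> f (x - h) \<ge> f x \<and> f x \<ge> f (x + h))"

definition substitutable_to :: "(real ^ 'n \<Rightarrow> real ^ 'n) \<Rightarrow> 'n \<Rightarrow> 'n \<Rightarrow> bool" where
  "substitutable_to q i j \<longleftrightarrow>
     (\<forall>\<mu>. locally_decreasing_at (\<lambda>t. q (\<chi> k. if k = i then t else \<mu> $ k) $ j) (\<mu> $ i))"

definition substitutable_choice_model :: "(real ^ 'n \<Rightarrow> real ^ 'n) \<Rightarrow> bool" where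
  "substitutable_choice_model q \<longleftrightarrow>
     choice_model q \<and> (\<forall>i j. i \<noteq> j \<longrightarrow> substitutable_to q i j)"

(* Generic over lattices so as to cover both real ^ 'n and the carriers Rn m below.
   Supermodularity is meant for functions avoiding -\<infinity>, submodularity for functions
   avoiding \<infinity>; for these the sums are never of the form \<infinity> + -\<infinity>. *)

definition supermodular_on :: "'a::lattice set \<Rightarrow> ('a \<Rightarrow> ereal) \<Rightarrow> bool" where
  "supermodular_on S f \<longleftrightarrow>
     (\<forall>x\<in>S. \<forall>y\<in>S. f (sup x y) + f (inf x y) \<ge> f x + f y)"

definition submodular_on :: "'a::lattice set \<Rightarrow> ('a \<Rightarrow> ereal) \<Rightarrow> bool" where
  "submodular_on S f \<longleftrightarrow> supermodular_on S (\<lambda>x. - f x)"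

definition proper :: "(real ^ 'n \<Rightarrow> ereal) \<Rightarrow> bool" where
  "proper f \<longleftrightarrow> (\<exists>x. f x < \<infinity>) \<and> (\<forall>x. f x > -\<infinity>)"

definition econvex :: "(real ^ 'n \<Rightarrow> ereal) \<Rightarrow> bool" where
  "econvex f \<longleftrightarrow>
     (\<forall>x y t. 0 < t \<and> t < 1 \<longrightarrow>
        f ((1 - t) *\<^sub>R x + t *\<^sub>R y) \<le> ereal (1 - t) * f x + ereal t * f y)"

definition strictly_econvex_on :: "(real ^ 'n) set \<Rightarrow> (real ^ 'n \<Rightarrow> ereal) \<Rightarrow> bool" where
  "strictly_econvex_on C f \<longleftrightarrow>
     (\<forall>x\<in>C. \<forall>y\<in>C. \<forall>t. x \<noteq> y \<and> 0 < t \<and> t < 1 \<longrightarrow>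
        f ((1 - t) *\<^sub>R x + t *\<^sub>R y) < ereal (1 - t) * f x + ereal t * f y)"

definition subdifferential :: "(real ^ 'n \<Rightarrow> ereal) \<Rightarrow> real ^ 'n \<Rightarrow> (real ^ 'n) set" where
  "subdifferential f x = {g. \<forall>y. f y \<ge> f x + ereal (g \<bullet> (y - x))}"

definition essentially_strictly_convex :: "(real ^ 'n \<Rightarrow> ereal) \<Rightarrow> bool" where
  "essentially_strictly_convex f \<longleftrightarrow>
     proper f \<and> econvex f \<and>
     (\<forall>C. convex C \<and> C \<subseteq> {x. subdifferential f x \<noteq> {}} \<longrightarrow> strictly_econvex_on C f)"

definition lower_semicontinuous :: "(real ^ 'n \<Rightarrow> ereal) \<Rightarrow> bool" where
  "lower_semicontinuous f \<longleftrightarrow> (\<forall>x. f x \<le> Liminf (at x) f)"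

(* A regularization function is given on the simplex only; it is encoded by its extension
   by \<infinity> to the whole space. The value \<infinity> is also allowed on the simplex. *)

definition regularization :: "(real ^ 'n \<Rightarrow> ereal) \<Rightarrow> bool" where
  "regularization V \<longleftrightarrow> (\<forall>x. x \<notin> prob_simplex \<longrightarrow> V x = \<infinity>) \<and> lower_semicontinuous V"

(* R^m for a number m (possibly 0): vectors (z 1, ..., z m), with no freedom outside {1..m}.
   It is a sublattice of nat \<Rightarrow> real under the pointwise operations. *)

definition Rn :: "nat \<Rightarrow> (nat \<Rightarrow> real) set" where
  "Rn m = extensional {1..m}"

(* The linear order on the index type identifies it with {1..CARD('n)}. *)

definition index_pos :: "'n::{finite,linorder} \<Rightarrow> nat" where
  "index_pos j = card {..j}"

definition insert_slack :: "'n::{finite,linorder} \<Rightarrow> (nat \<Rightarrow> real) \<Rightarrow> real ^ 'n::{finite,linorder}" where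
  "insert_slack i z =
     (\<chi> j. if j < i then z (index_pos j)
          else if j = i then 1 - (\<Sum>k = 1..CARD('n) - 1. z k)
          else z (index_pos j - 1))"

definition Vbar ::
  "(real ^ 'n::{finite,linorder} \<Rightarrow> ereal) \<Rightarrow> 'n::{finite,linorder} \<Rightarrow> (nat \<Rightarrow> real) \<Rightarrow> ereal" where
  "Vbar V i z =
     (if (\<Sum>k = 1..CARD('n) - 1. z k) \<le> 1 \<and> (\<forall>k\<in>{1..CARD('n) - 1}. 0 \<le> z k)
      then V (insert_slack i z) else \<infinity>)"

(* The maximizer over the simplex exists, is unique and equals q \<mu>. *)

definition argmax_representation ::
  "(real ^ 'n \<Rightarrow> real ^ 'n) \<Rightarrow> (real ^ 'n \<Rightarrow> ereal) \<Rightarrow> bool" where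
  "argmax_representation q V \<longleftrightarrow>
     (\<forall>\<mu>. {x. is_arg_max (\<lambda>x. ereal (\<mu> \<bullet> x) - V x) (\<lambda>x. x \<in> prob_simplex) x} = {q \<mu>})"

end

theory Submission
  imports Defs
begin

text \<open>
  A function on the line that is locally decreasing everywhere is decreasing, so
  substitutability says that each partial derivative \<open>q\<^sub>j\<close> of \<open>w\<close> is antitone in
  \<open>\<mu>\<^sub>i\<close> for \<open>i \<noteq> j\<close>. For a differentiable function this is submodularity:
  difference quotients give one direction, and integrating the gradient along one of two
  increments with disjoint supports gives the other
  (\<open>submodular_iff_gradient_antitone\<close>).

  The regularization function is the convex conjugate of \<open>w\<close>. Monotonicity and translation
  invariance make it \<open>\<infinity>\<close> off the simplex. By uniqueness of subgradients of the differentiable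
  function \<open>w\<close>, the Fenchel-Young inequality at \<open>\<mu>\<close> is tight at \<open>q \<mu>\<close> only; this yields
  both the representation by a unique maximizer and essential strict convexity, and no
  biconjugation theorem is needed. The conjugate of a submodular function is supermodular
  by the rearrangement inequality: replacing two dual vectors by their join and meet does not
  decrease the sum of their pairings with the join and meet of the two points
  (\<open>slack_supermodular_conjugate\<close>). Translation invariance removes the slack coordinate from
  this argument.

  For the converse with three alternatives, fix \<open>j \<noteq> k\<close> and let \<open>i\<close> be the third one.
  In the plane of the coordinates \<open>j\<close> and \<open>k\<close>, reversing one axis turns a supermodular
  function into a submodular one, a fact special to dimension two. So the maximizers at two
  dual vectors may be recombined, and the conjugate of \<open>V\<close> has decreasing
  differences in \<open>(\<mu>\<^sub>j, \<mu>\<^sub>k)\<close>. Since \<open>q\<close> selects its subgradients,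
  \<open>q\<^sub>j(\<mu> + t e\<^sub>k) \<le> q\<^sub>j(\<mu> + s e\<^sub>j)\<close> for all \<open>s > 0\<close>, and \<open>s \<rightarrow> 0\<close> concludes
  (\<open>slack_supermodular_imp_substitutable_3\<close>).
\<close>

section \<open>Local and global monotonicity\<close>

lemma locally_decreasing_everywhere_iff_antimono:
  "(\<forall>x. locally_decreasing_at f x) \<longleftrightarrow> antimono f"
proof
  assume loc: "\<forall>x. locally_decreasing_at f x"
  show "antimono f"
  proof (rule antimonoI)
    fix x y :: real
    assume "x \<le> y"
    then show "f y \<le> f x"
    proof (induction rule: Bolzano)
      case (trans a b c)
      then show ?case by linarith
    next
      case (local z)
      obtain d where "d > 0"
        and d: "\<And>h. 0 < h \<Longrightarrow> h < d \<Longrightarrow> f (z - h) \<ge> f z \<and> f z \<ge> f (z + h)"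
        using loc unfolding locally_decreasing_at_def by blast
      have "f b \<le> f a" if "a \<le> z" "z \<le> b" "b - a < d" for a b
      proof -
        have "f z \<le> f a" using d[of "z - a"] that by (cases "a = z") auto
        moreover have "f b \<le> f z" using d[of "b - z"] that by (cases "b = z") auto
        ultimately show ?thesis by linarith
      qed
      with \<open>d > 0\<close> show ?case by blast
    qed
  qed
next
  assume "antimono f"
  then have "f (x - h) \<ge> f x \<and> f x \<ge> f (x + h)" if "0 < h" for x h
    using that by (auto intro: antimonoD)
  then show "\<forall>x. locally_decreasing_at f x"
    unfolding locally_decreasing_at_def by (meson zero_less_one)
qed

lemma substitutable_to_iff:
  fixes q :: "real ^ 'n \<Rightarrow> real ^ 'n"
  shows "substitutable_to q i j \<longleftrightarrow> (\<forall>\<mu> t. 0 \<le> t \<longrightarrow> q (\<mu> + t *\<^sub>R axis i 1) $ j \<le> q \<mu> $ j)"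
proof -
  define f where "f = (\<lambda>\<mu> t. q (\<chi> k. if k = i then t else \<mu> $ k) $ j)"
  have upd: "(\<chi> k. if k = i then t else \<mu> $ k) = \<mu> + (t - \<mu> $ i) *\<^sub>R axis i 1"
    for \<mu> :: "real ^ 'n" and t
    by (simp add: vec_eq_iff axis_def)
  \<comment> \<open>Every point of the coordinate line through \<open>\<mu>\<close> is the base point of the same line,
    so the pointwise condition is imposed on the whole line.\<close>
  have "substitutable_to q i j \<longleftrightarrow> (\<forall>\<mu> t. locally_decreasing_at (f \<mu>) t)"
  proof
    assume sub: "substitutable_to q i j"
    show "\<forall>\<mu> t. locally_decreasing_at (f \<mu>) t"
    proof (intro allI)
      fix \<mu> t
      have "f (\<chi> k. if k = i then t else \<mu> $ k) = f \<mu>"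
        by (auto simp: f_def fun_eq_iff intro!: arg_cong[where f = "\<lambda>x. q x $ j"] simp: vec_eq_iff)
      moreover have "locally_decreasing_at (f (\<chi> k. if k = i then t else \<mu> $ k))
          ((\<chi> k. if k = i then t else \<mu> $ k) $ i)"
        using sub unfolding substitutable_to_def f_def by blast
      ultimately show "locally_decreasing_at (f \<mu>) t" by simp
    qed
  qed (simp add: substitutable_to_def f_def)
  also have "\<dots> \<longleftrightarrow> (\<forall>\<mu>. antimono (f \<mu>))"
    by (simp add: locally_decreasing_everywhere_iff_antimono)
  also have "\<dots> \<longleftrightarrow> (\<forall>\<mu> t. 0 \<le> t \<longrightarrow> q (\<mu> + t *\<^sub>R axis i 1) $ j \<le> q \<mu> $ j)"
  proof (intro iffI allI impI)
    fix \<mu> :: "real ^ 'n" and t :: real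
    assume "\<forall>\<mu>. antimono (f \<mu>)" "0 \<le> t"
    then have "f \<mu> (\<mu> $ i + t) \<le> f \<mu> (\<mu> $ i)"
      by (intro antimonoD[of "f \<mu>"]) auto
    then show "q (\<mu> + t *\<^sub>R axis i 1) $ j \<le> q \<mu> $ j"
      by (simp add: f_def upd)
  next
    fix \<mu> :: "real ^ 'n"
    assume *: "\<forall>\<mu> t. 0 \<le> t \<longrightarrow> q (\<mu> + t *\<^sub>R axis i 1) $ j \<le> q \<mu> $ j"
    show "antimono (f \<mu>)"
    proof (rule antimonoI)
      fix s t :: real
      assume "s \<le> t"
      then have "q ((\<mu> + (s - \<mu> $ i) *\<^sub>R axis i 1) + (t - s) *\<^sub>R axis i 1) $ j
          \<le> q (\<mu> + (s - \<mu> $ i) *\<^sub>R axis i 1) $ j"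
        using * by (meson diff_ge_0_iff_ge)
      moreover have "(\<mu> + (s - \<mu> $ i) *\<^sub>R axis i 1) + (t - s) *\<^sub>R axis i 1
          = \<mu> + (t - \<mu> $ i) *\<^sub>R axis i 1"
        by (simp add: vec_eq_iff algebra_simps)
      ultimately show "f \<mu> t \<le> f \<mu> s"
        by (simp add: f_def upd)
    qed
  qed
  finally show ?thesis .
qed

section \<open>Gradients of convex functions\<close>

lemma GDERIV_line:
  fixes w :: "'a::real_inner \<Rightarrow> real"
  assumes "GDERIV w (\<mu> + t *\<^sub>R h) :> D"
  shows "((\<lambda>s. w (\<mu> + s *\<^sub>R h)) has_real_derivative (h \<bullet> D)) (at t)"
proof -
  have "((\<lambda>s. \<mu> + s *\<^sub>R h) has_derivative (\<lambda>s. s *\<^sub>R h)) (at t)"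
    by (auto intro!: derivative_eq_intros)
  from has_derivative_compose[OF this, of w "\<lambda>k. k \<bullet> D"] assms
  show ?thesis
    by (simp add: gderiv_def has_field_derivative_def mult_commute_abs)
qed

lemma GDERIV_right_quotient:
  fixes w :: "'a::real_inner \<Rightarrow> real"
  assumes "GDERIV w \<mu> :> D"
  shows "((\<lambda>s. (w (\<mu> + s *\<^sub>R h) - w \<mu>) / s) \<longlongrightarrow> h \<bullet> D) (at_right 0)"
proof -
  have "((\<lambda>s. w (\<mu> + s *\<^sub>R h)) has_real_derivative (h \<bullet> D)) (at 0)"
    using assms by (intro GDERIV_line) simp
  then show ?thesis
    by (auto simp: DERIV_def filterlim_at_split)
qed

lemma convex_GDERIV_above_tangent:
  fixes w :: "'a::real_inner \<Rightarrow> real"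
  assumes "convex_on UNIV w" "GDERIV w \<mu> :> D"
  shows "w \<mu> + D \<bullet> (\<nu> - \<mu>) \<le> w \<nu>"
proof -
  have "(\<nu> - \<mu>) \<bullet> D \<le> w \<nu> - w \<mu>"
  proof (rule tendsto_upperbound)
    show "((\<lambda>s. (w (\<mu> + s *\<^sub>R (\<nu> - \<mu>)) - w \<mu>) / s) \<longlongrightarrow> (\<nu> - \<mu>) \<bullet> D) (at_right 0)"
      using assms(2) by (rule GDERIV_right_quotient)
    have "(w (\<mu> + s *\<^sub>R (\<nu> - \<mu>)) - w \<mu>) / s \<le> w \<nu> - w \<mu>" if "0 < s" "s < 1" for s
    proof -
      have "\<mu> + s *\<^sub>R (\<nu> - \<mu>) = (1 - s) *\<^sub>R \<mu> + s *\<^sub>R \<nu>"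
        by (simp add: algebra_simps)
      then have "w (\<mu> + s *\<^sub>R (\<nu> - \<mu>)) \<le> (1 - s) * w \<mu> + s * w \<nu>"
        using convex_onD[OF assms(1), of s \<mu> \<nu>] that by simp
      then show ?thesis using that by (simp add: field_simps)
    qed
    then show "\<forall>\<^sub>F s in at_right 0. (w (\<mu> + s *\<^sub>R (\<nu> - \<mu>)) - w \<mu>) / s \<le> w \<nu> - w \<mu>"
      by (intro eventually_at_rightI[of 0 1]) auto
  qed simp
  then show ?thesis by (simp add: inner_commute)
qed

lemma GDERIV_unique_subgradient:
  fixes w :: "'a::real_inner \<Rightarrow> real"
  assumes "GDERIV w \<mu> :> D" and sub: "\<And>\<nu>. w \<mu> + g \<bullet> (\<nu> - \<mu>) \<le> w \<nu>"
  shows "g = D"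
proof -
  have "((\<lambda>\<nu>. w \<nu> - \<nu> \<bullet> g) has_derivative (\<lambda>h. h \<bullet> D - h \<bullet> g)) (at \<mu>)"
    using assms(1) unfolding gderiv_def by (auto intro!: derivative_eq_intros)
  then have "(\<lambda>h. h \<bullet> D - h \<bullet> g) = (\<lambda>h. 0)"
    by (rule differential_zero_maxmin[OF UNIV_I open_UNIV])
      (use sub in \<open>auto simp: inner_diff_right inner_commute algebra_simps\<close>)
  then have "(D - g) \<bullet> D - (D - g) \<bullet> g = 0"
    by metis
  then have "(D - g) \<bullet> (D - g) = 0"
    by (simp add: inner_diff_right)
  then show ?thesis by simp
qed

section \<open>Submodularity and monotone partial derivatives\<close>

lemma submodular_on_real_iff:
  "submodular_on S (\<lambda>x. ereal (w x)) \<longleftrightarrow>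
    (\<forall>x\<in>S. \<forall>y\<in>S. w (sup x y) + w (inf x y) \<le> w x + w y)"
proof -
  have "- a - b \<le> - c - d \<longleftrightarrow> c + d \<le> a + b" for a b c d :: real
    by linarith
  then show ?thesis
    by (simp add: submodular_on_def supermodular_on_def)
qed

lemma vec_sup_inf_component [simp]:
  fixes x y :: "real ^ 'n"
  shows "sup x y $ k = max (x $ k) (y $ k)" "inf x y $ k = min (x $ k) (y $ k)"
  by (simp_all add: sup_vec_def inf_vec_def sup_real_def inf_real_def)

lemma antitone_other_coordinates:
  fixes q :: "real ^ 'n \<Rightarrow> real ^ 'n"
  assumes anti: "\<And>i \<mu> t. i \<noteq> j \<Longrightarrow> 0 \<le> t \<Longrightarrow> q (\<mu> + t *\<^sub>R axis i 1) $ j \<le> q \<mu> $ j"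
    and a: "\<And>i. 0 \<le> a $ i" "a $ j = 0"
  shows "q (\<mu> + a) $ j \<le> q \<mu> $ j"
proof -
  have "q (\<mu> + (\<Sum>i\<in>S. a $ i *\<^sub>R axis i 1)) $ j \<le> q \<mu> $ j" if "finite S" "j \<notin> S" for S
    using that
  proof (induction S)
    case (insert i S)
    have "q ((\<mu> + (\<Sum>k\<in>S. a $ k *\<^sub>R axis k 1)) + a $ i *\<^sub>R axis i 1) $ j
        \<le> q (\<mu> + (\<Sum>k\<in>S. a $ k *\<^sub>R axis k 1)) $ j"
      using insert.prems a by (intro anti) auto
    with insert show ?case by (simp add: algebra_simps)
  qed simp
  moreover have "(\<Sum>i\<in>-{j}. a $ i *\<^sub>R axis i 1) = a"
  proof -
    have "(\<Sum>i\<in>-{j}. a $ i *\<^sub>R axis i 1) $ k = a $ k" for k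
    proof -
      have "(\<Sum>i\<in>-{j}. a $ i *\<^sub>R axis i 1) $ k = (\<Sum>i\<in>-{j}. if i = k then a $ i else 0)"
        by (simp add: axis_def if_distrib[of "(*) _"] eq_commute[of k] cong: if_cong)
      also have "\<dots> = a $ k" using a by (auto simp: sum.delta)
      finally show ?thesis .
    qed
    then show ?thesis by (simp add: vec_eq_iff)
  qed
  ultimately show ?thesis by (metis ComplD finite_code singletonI)
qed

lemma submodular_iff_gradient_antitone:
  fixes w :: "real ^ 'n \<Rightarrow> real"
  assumes grad: "\<And>\<mu>. GDERIV w \<mu> :> q \<mu>"
  shows "submodular_on UNIV (\<lambda>\<mu>. ereal (w \<mu>)) \<longleftrightarrow> (\<forall>i j. i \<noteq> j \<longrightarrow> substitutable_to q i j)"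
proof
  assume sub: "submodular_on UNIV (\<lambda>\<mu>. ereal (w \<mu>))"
  show "\<forall>i j. i \<noteq> j \<longrightarrow> substitutable_to q i j"
    unfolding substitutable_to_iff
  proof (intro allI impI)
    fix i j :: 'n and \<mu> :: "real ^ 'n" and t :: real
    assume "i \<noteq> j" "0 \<le> t"
    define \<nu> where "\<nu> = \<mu> + t *\<^sub>R axis i 1"
    have "axis j 1 \<bullet> q \<nu> \<le> axis j 1 \<bullet> q \<mu>"
    proof (rule tendsto_le)
      show "((\<lambda>s. (w (\<nu> + s *\<^sub>R axis j 1) - w \<nu>) / s) \<longlongrightarrow> axis j 1 \<bullet> q \<nu>) (at_right 0)"
        and "((\<lambda>s. (w (\<mu> + s *\<^sub>R axis j 1) - w \<mu>) / s) \<longlongrightarrow> axis j 1 \<bullet> q \<mu>) (at_right 0)"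
        by (rule GDERIV_right_quotient[OF grad])+
      have "(w (\<nu> + s *\<^sub>R axis j 1) - w \<nu>) / s \<le> (w (\<mu> + s *\<^sub>R axis j 1) - w \<mu>) / s"
        if "0 < s" for s
      proof -
        have "sup \<nu> (\<mu> + s *\<^sub>R axis j 1) = \<nu> + s *\<^sub>R axis j 1"
          "inf \<nu> (\<mu> + s *\<^sub>R axis j 1) = \<mu>"
          using \<open>i \<noteq> j\<close> \<open>0 \<le> t\<close> that by (auto simp: vec_eq_iff \<nu>_def axis_def)
        then have "w (\<nu> + s *\<^sub>R axis j 1) + w \<mu> \<le> w \<nu> + w (\<mu> + s *\<^sub>R axis j 1)"
          using sub unfolding submodular_on_real_iff by (metis UNIV_I)
        then show ?thesis using that by (simp add: divide_right_mono)
      qed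
      then show "\<forall>\<^sub>F s in at_right 0.
          (w (\<nu> + s *\<^sub>R axis j 1) - w \<nu>) / s \<le> (w (\<mu> + s *\<^sub>R axis j 1) - w \<mu>) / s"
        by (intro eventually_at_rightI[of 0 1]) auto
    qed simp
    then show "q (\<mu> + t *\<^sub>R axis i 1) $ j \<le> q \<mu> $ j"
      by (simp add: \<nu>_def inner_axis')
  qed
next
  assume subst: "\<forall>i j. i \<noteq> j \<longrightarrow> substitutable_to q i j"
  have "w (sup x y) + w (inf x y) \<le> w x + w y" for x y
  proof -
    \<comment> \<open>The two increments over the meet have disjoint supports.\<close>
    define m a b where "m = inf x y" and "a = x - m" and "b = y - m"
    have ab: "0 \<le> a $ k" "0 \<le> b $ k" "a $ k = 0 \<or> b $ k = 0" for k
      by (auto simp: a_def b_def m_def min_def)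
    define \<phi> where "\<phi> = (\<lambda>t. w ((m + a) + t *\<^sub>R b) - w (m + t *\<^sub>R b))"
    have "\<phi> 1 \<le> \<phi> 0"
    proof (rule DERIV_nonpos_imp_nonincreasing[of 0 1 \<phi>])
      fix t :: real
      have "(\<phi> has_real_derivative (b \<bullet> q ((m + a) + t *\<^sub>R b) - b \<bullet> q (m + t *\<^sub>R b))) (at t)"
        unfolding \<phi>_def by (intro derivative_intros GDERIV_line grad)
      moreover have "b \<bullet> q ((m + a) + t *\<^sub>R b) \<le> b \<bullet> q (m + t *\<^sub>R b)"
        unfolding inner_vec_def
      proof (rule sum_mono)
        fix j
        show "b $ j \<bullet> q ((m + a) + t *\<^sub>R b) $ j \<le> b $ j \<bullet> q (m + t *\<^sub>R b) $ j"
        proof (cases "b $ j = 0")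
          case False
          have "q ((m + t *\<^sub>R b) + a) $ j \<le> q (m + t *\<^sub>R b) $ j"
          proof (rule antitone_other_coordinates[where q = q])
            show "q (\<mu> + s *\<^sub>R axis i 1) $ j \<le> q \<mu> $ j" if "i \<noteq> j" "0 \<le> s" for i \<mu> s
              using subst that by (simp add: substitutable_to_iff)
            show "0 \<le> a $ i" for i by (rule ab)
            show "a $ j = 0" using ab(3)[of j] False by simp
          qed
          then have "q ((m + a) + t *\<^sub>R b) $ j \<le> q (m + t *\<^sub>R b) $ j"
            by (simp add: add_ac)
          then show ?thesis using ab(2) by (simp add: mult_left_mono)
        qed simp
      qed
      ultimately show "\<exists>y. (\<phi> has_real_derivative y) (at t) \<and> y \<le> 0"
        by (meson diff_le_0_iff_le)
    qed simp
    moreover have "m + a = x" "m + b = y" "m + a + b = sup x y"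
      by (auto simp: vec_eq_iff a_def b_def m_def)
    ultimately show ?thesis by (simp add: \<phi>_def m_def)
  qed
  then show "submodular_on UNIV (\<lambda>\<mu>. ereal (w \<mu>))"
    by (simp add: submodular_on_real_iff)
qed

section \<open>The convex conjugate of a choice welfare function\<close>

text \<open>The convex conjugate (Legendre-Fenchel transform) of \<open>w\<close>, with values in
  \<open>(-\<infinity>, \<infinity>]\<close>.\<close>

definition conjugate :: "(real ^ 'n \<Rightarrow> real) \<Rightarrow> real ^ 'n \<Rightarrow> ereal" where
  "conjugate w x = (SUP \<mu>. ereal (\<mu> \<bullet> x - w \<mu>))"

lemma conjugate_ge: "ereal (\<mu> \<bullet> x - w \<mu>) \<le> conjugate w x"
  unfolding conjugate_def by (rule SUP_upper) simp

lemma conjugate_gt_minus_infinity: "- \<infinity> < conjugate w x"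
  using conjugate_ge[of 0 x w] by (cases "conjugate w x") auto

lemma conjugate_at_gradient:
  assumes "convex_on UNIV w" "GDERIV w \<mu> :> D"
  shows "conjugate w D = ereal (\<mu> \<bullet> D - w \<mu>)"
proof (rule antisym)
  show "conjugate w D \<le> ereal (\<mu> \<bullet> D - w \<mu>)"
    unfolding conjugate_def
  proof (rule SUP_least)
    fix \<nu> :: "real ^ 'a"
    show "ereal (\<nu> \<bullet> D - w \<nu>) \<le> ereal (\<mu> \<bullet> D - w \<mu>)"
      using convex_GDERIV_above_tangent[OF assms, of \<nu>]
      by (simp add: inner_diff_right inner_commute)
  qed
qed (rule conjugate_ge)

text \<open>Equality in the Fenchel-Young inequality identifies the gradient.\<close>

lemma conjugate_tight_imp_gradient:
  assumes "GDERIV w \<mu> :> D" "conjugate w x \<le> ereal (\<mu> \<bullet> x - w \<mu>)"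
  shows "x = D"
proof (rule GDERIV_unique_subgradient[OF assms(1)])
  fix \<nu>
  have "\<nu> \<bullet> x - w \<nu> \<le> \<mu> \<bullet> x - w \<mu>"
    using conjugate_ge[of \<nu> x w] assms(2) by (metis ereal_less_eq(3) order_trans)
  then show "w \<mu> + x \<bullet> (\<nu> - \<mu>) \<le> w \<nu>"
    by (simp add: inner_diff_right inner_commute)
qed

lemma inner_one_vec: "(1 :: real ^ 'n) \<bullet> x = (\<Sum>i\<in>UNIV. x $ i)"
  by (simp add: inner_vec_def)

text \<open>The supremum is unbounded along the all-ones direction if the coordinates of \<open>x\<close> do not
  sum to 1, by translation invariance, and along \<open>- e\<^sub>i\<close> if \<open>x\<^sub>i < 0\<close>, by
  monotonicity.\<close>

lemma conjugate_infinite_off_simplex: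
  assumes "diff_choice_welfare w" "x \<notin> prob_simplex"
  shows "conjugate w x = \<infinity>"
proof -
  have w_trans: "\<And>\<mu> t. w (\<mu> + t *\<^sub>R vec 1) = w \<mu> + t" and w_mono: "mono w"
    using assms(1) by (auto simp: diff_choice_welfare_def)
  have unbounded: "conjugate w x = \<infinity>" if "\<And>c. \<exists>\<mu>. c \<le> \<mu> \<bullet> x - w \<mu>"
    unfolding conjugate_def using that by (intro SUP_PInfty) auto
  show ?thesis
  proof (cases "(\<Sum>i\<in>UNIV. x $ i) = 1")
    case False
    show ?thesis
    proof (rule unbounded)
      fix c
      define t where "t = (c + w 0) / ((\<Sum>i\<in>UNIV. x $ i) - 1)"
      have "(t *\<^sub>R vec 1) \<bullet> x - w (t *\<^sub>R vec 1) = t * ((\<Sum>i\<in>UNIV. x $ i) - 1) - w 0"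
        using w_trans[of 0 t] by (simp add: inner_one_vec algebra_simps)
      also have "\<dots> = c" using False by (simp add: t_def)
      finally show "\<exists>\<mu>. c \<le> \<mu> \<bullet> x - w \<mu>" by (metis order_refl)
    qed
  next
    case True
    then obtain i where i: "x $ i < 0"
      using assms(2) by (auto simp: prob_simplex_def not_le)
    show ?thesis
    proof (rule unbounded)
      fix c
      define t where "t = max 0 ((c + w 0) / (- (x $ i)))"
      have "c + w 0 \<le> t * (- (x $ i))"
        using i unfolding t_def by (subst pos_divide_le_eq[symmetric]) auto
      moreover have "w (- t *\<^sub>R axis i 1) \<le> w 0"
        by (rule monoD[OF w_mono]) (auto simp: less_eq_vec_def axis_def t_def)
      moreover have "(- t *\<^sub>R axis i 1) \<bullet> x = t * (- (x $ i))"
        by (simp add: inner_axis inner_commute[of _ x])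
      ultimately show "\<exists>\<mu>. c \<le> \<mu> \<bullet> x - w \<mu>"
        by (intro exI[of _ "- t *\<^sub>R axis i 1"]) linarith
    qed
  qed
qed

lemma lower_semicontinuous_conjugate: "lower_semicontinuous (conjugate w)"
  unfolding lower_semicontinuous_def
proof
  fix x :: "real ^ 'a"
  show "conjugate w x \<le> Liminf (at x) (conjugate w)"
    unfolding conjugate_def[of w x]
  proof (rule SUP_least)
    fix \<mu>
    have "((\<lambda>y. ereal (\<mu> \<bullet> y - w \<mu>)) \<longlongrightarrow> ereal (\<mu> \<bullet> x - w \<mu>)) (at x)"
      by (intro tendsto_intros)
    then have "ereal (\<mu> \<bullet> x - w \<mu>) = Liminf (at x) (\<lambda>y. ereal (\<mu> \<bullet> y - w \<mu>))"
      by (intro lim_imp_Liminf[symmetric]) simp_all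
    also have "\<dots> \<le> Liminf (at x) (conjugate w)"
      by (intro Liminf_mono always_eventually allI conjugate_ge)
    finally show "ereal (\<mu> \<bullet> x - w \<mu>) \<le> Liminf (at x) (conjugate w)" .
  qed
qed

lemma econvex_conjugate: "econvex (conjugate w)"
  unfolding econvex_def
proof (intro allI impI, elim conjE)
  fix x y :: "real ^ 'a" and t :: real
  assume t: "0 < t" "t < 1"
  show "conjugate w ((1 - t) *\<^sub>R x + t *\<^sub>R y) \<le> ereal (1 - t) * conjugate w x + ereal t * conjugate w y"
    unfolding conjugate_def[of w "(1 - t) *\<^sub>R x + t *\<^sub>R y"]
  proof (rule SUP_least)
    fix \<mu>
    have "ereal (\<mu> \<bullet> ((1 - t) *\<^sub>R x + t *\<^sub>R y) - w \<mu>)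
        = ereal (1 - t) * ereal (\<mu> \<bullet> x - w \<mu>) + ereal t * ereal (\<mu> \<bullet> y - w \<mu>)"
      by (simp add: inner_add_right algebra_simps)
    also have "\<dots> \<le> ereal (1 - t) * conjugate w x + ereal t * conjugate w y"
      using t by (intro add_mono ereal_mult_left_mono conjugate_ge) auto
    finally show "ereal (\<mu> \<bullet> ((1 - t) *\<^sub>R x + t *\<^sub>R y) - w \<mu>)
        \<le> ereal (1 - t) * conjugate w x + ereal t * conjugate w y" .
  qed
qed

lemma proper_subdifferential_imp_finite:
  assumes "proper f" "subdifferential f x \<noteq> {}"
  shows "\<exists>c. f x = ereal c"
proof -
  obtain g where g: "\<And>y. f x + ereal (g \<bullet> (y - x)) \<le> f y"
    using assms(2) by (auto simp: subdifferential_def)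
  obtain y where "f y < \<infinity>" using assms(1) by (auto simp: proper_def)
  with g[of y] have "f x \<noteq> \<infinity>" by auto
  moreover have "f x \<noteq> - \<infinity>" using assms(1) unfolding proper_def by (metis order_less_irrefl)
  ultimately show ?thesis by (cases "f x") auto
qed

text \<open>Differentiability of \<open>w\<close> makes its conjugate essentially strictly convex: were the
  conjugate affine between two points \<open>x\<close> and \<open>y\<close>, a subgradient \<open>\<mu>\<close> at an
  intermediate point would make the Fenchel-Young inequality tight at both ends, and so both
  would be the gradient of \<open>w\<close> at \<open>\<mu>\<close>.\<close>

lemma essentially_strictly_convex_conjugate:
  assumes conv: "convex_on UNIV w" and grad: "\<And>\<mu>. GDERIV w \<mu> :> q \<mu>"
  shows "essentially_strictly_convex (conjugate w)"
proof -
  let ?V = "conjugate w"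
  have proper: "proper ?V"
    unfolding proper_def
    using conjugate_at_gradient[OF conv grad[of 0]] conjugate_gt_minus_infinity[of w]
    by (auto intro!: exI[of _ "q 0"])
  have tight: "z = q \<mu>"
    if z: "?V z = ereal c" and sub: "\<And>y. ?V y \<ge> ereal (c + \<mu> \<bullet> (y - z))" for z c \<mu>
  proof (rule conjugate_tight_imp_gradient[OF grad])
    have "c + \<mu> \<bullet> (q \<mu> - z) \<le> \<mu> \<bullet> q \<mu> - w \<mu>"
      using sub[of "q \<mu>"] conjugate_at_gradient[OF conv grad[of \<mu>]] by simp
    then show "?V z \<le> ereal (\<mu> \<bullet> z - w \<mu>)"
      using z by (simp add: inner_diff_right)
  qed
  have "strictly_econvex_on C ?V"
    if C: "convex C" "C \<subseteq> {x. subdifferential ?V x \<noteq> {}}" for C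
    unfolding strictly_econvex_on_def
  proof (intro ballI allI impI, elim conjE)
    fix x y and t :: real
    assume xy: "x \<in> C" "y \<in> C" "x \<noteq> y" and t: "0 < t" "t < 1"
    define z where "z = (1 - t) *\<^sub>R x + t *\<^sub>R y"
    have "z \<in> C"
      unfolding z_def using C(1) xy t by (intro convexD_alt) auto
    have fin: "\<exists>c. ?V v = ereal c" if "v \<in> C" for v
      by (rule proper_subdifferential_imp_finite[OF proper]) (use subsetD[OF C(2) that] in simp)
    obtain a b c where abc: "?V x = ereal a" "?V y = ereal b" "?V z = ereal c"
      using fin[OF xy(1)] fin[OF xy(2)] fin[OF \<open>z \<in> C\<close>] by auto
    have "subdifferential ?V z \<noteq> {}"
      using subsetD[OF C(2) \<open>z \<in> C\<close>] by simp
    then obtain \<mu> where "\<mu> \<in> subdifferential ?V z"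
      by (rule ex_in_conv[THEN iffD2, THEN exE])
    then have \<mu>: "?V y' \<ge> ereal (c + \<mu> \<bullet> (y' - z))" for y'
      by (simp add: subdifferential_def abc(3))
    have at_x: "c + \<mu> \<bullet> (x - z) \<le> a" and at_y: "c + \<mu> \<bullet> (y - z) \<le> b"
      using \<mu>[of x] \<mu>[of y] abc by simp_all
    have zero: "(1 - t) * (\<mu> \<bullet> (x - z)) + t * (\<mu> \<bullet> (y - z)) = 0"
      by (simp add: z_def inner_diff_right inner_add_right algebra_simps)
    have "c < (1 - t) * a + t * b"
    proof (rule ccontr)
      assume "\<not> c < (1 - t) * a + t * b"
      moreover have "(1 - t) * (c + \<mu> \<bullet> (x - z)) \<le> (1 - t) * a" "t * (c + \<mu> \<bullet> (y - z)) \<le> t * b"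
        using at_x at_y t by (auto intro: mult_left_mono)
      moreover have "(1 - t) * (c + \<mu> \<bullet> (x - z)) + t * (c + \<mu> \<bullet> (y - z)) = c"
        using zero by (simp add: algebra_simps)
      ultimately have "(1 - t) * (c + \<mu> \<bullet> (x - z)) = (1 - t) * a"
        "t * (c + \<mu> \<bullet> (y - z)) = t * b"
        by linarith+
      then have eqs: "a = c + \<mu> \<bullet> (x - z)" "b = c + \<mu> \<bullet> (y - z)"
        using t by auto
      have "x = q \<mu>" "y = q \<mu>"
        using \<mu> by (auto intro!: tight[OF abc(1)] tight[OF abc(2)] simp: eqs inner_diff_right)
      with xy show False by simp
    qed
    then show "?V ((1 - t) *\<^sub>R x + t *\<^sub>R y) < ereal (1 - t) * ?V x + ereal t * ?V y"
      using abc by (simp add: z_def[symmetric])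
  qed
  with proper econvex_conjugate show ?thesis
    by (simp add: essentially_strictly_convex_def)
qed

lemma argmax_representation_conjugate:
  assumes "choice_model q" and conv: "convex_on UNIV w" and grad: "\<And>\<mu>. GDERIV w \<mu> :> q \<mu>"
  shows "argmax_representation q (conjugate w)"
  unfolding argmax_representation_def
proof (intro allI set_eqI)
  fix \<mu> x
  let ?f = "\<lambda>x. ereal (\<mu> \<bullet> x) - conjugate w x"
  have val: "?f (q \<mu>) = ereal (w \<mu>)"
    by (simp add: conjugate_at_gradient[OF conv grad])
  have le: "?f y \<le> ereal (w \<mu>)" for y
    using conjugate_ge[of \<mu> y w] by (cases "conjugate w y") auto
  have eq: "y = q \<mu>" if "ereal (w \<mu>) \<le> ?f y" for y
    using that by (intro conjugate_tight_imp_gradient[OF grad]) (cases "conjugate w y"; simp)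
  have "q \<mu> \<in> prob_simplex" using assms(1) by (auto simp: choice_model_def)
  then have "is_arg_max ?f (\<lambda>x. x \<in> prob_simplex) x \<longleftrightarrow> x = q \<mu>"
    unfolding is_arg_max_linorder using val le eq[of x] by (auto simp del: ereal_less_eq)
  then show "x \<in> {x. is_arg_max ?f (\<lambda>x. x \<in> prob_simplex) x} \<longleftrightarrow> x \<in> {q \<mu>}"
    by simp
qed

section \<open>Supermodularity in reduced coordinates\<close>

text \<open>Supermodularity of \<open>V\<close> with respect to the componentwise order of the coordinates other
  than \<open>i\<close>, for points of the hyperplane \<open>\<Sum>\<^sub>j x\<^sub>j = 1\<close>, where the \<open>i\<close>-th
  coordinate is determined by the others: \<open>u\<close> and \<open>l\<close> are the join and the meet of
  \<open>x\<close> and \<open>y\<close> in this order.\<close>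

definition slack_supermodular :: "(real ^ 'n \<Rightarrow> ereal) \<Rightarrow> 'n \<Rightarrow> bool" where
  "slack_supermodular V i \<longleftrightarrow>
    (\<forall>x y u l. (\<Sum>j\<in>UNIV. x $ j) = 1 \<and> (\<Sum>j\<in>UNIV. y $ j) = 1 \<and>
       (\<Sum>j\<in>UNIV. u $ j) = 1 \<and> (\<Sum>j\<in>UNIV. l $ j) = 1 \<and>
       (\<forall>j. j \<noteq> i \<longrightarrow> u $ j = max (x $ j) (y $ j) \<and> l $ j = min (x $ j) (y $ j)) \<longrightarrow>
       V x + V y \<le> V u + V l)"

text \<open>The position in \<open>{1..n-1}\<close> from which a coordinate other than \<open>i\<close> is read.\<close>

definition reduced_pos :: "'n::{finite,linorder} \<Rightarrow> 'n \<Rightarrow> nat" where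
  "reduced_pos i j = (if j < i then index_pos j else index_pos j - 1)"

lemma index_pos_strict_mono: "i < j \<Longrightarrow> index_pos i < index_pos j"
  unfolding index_pos_def by (rule psubset_card_mono) auto

lemma index_pos_bounds: "1 \<le> index_pos i" "index_pos i \<le> CARD('n)"
  for i :: "'n::{finite,linorder}"
  unfolding index_pos_def by (auto simp: Suc_le_eq card_gt_0_iff intro: card_mono)

lemma bij_betw_reduced_pos:
  fixes i :: "'n::{finite,linorder}"
  shows "bij_betw (reduced_pos i) (- {i}) {1..CARD('n) - 1}"
proof -
  have less: "reduced_pos i j < reduced_pos i k" if "j < k" "j \<noteq> i" "k \<noteq> i" for j k
    using that index_pos_strict_mono[of j k] index_pos_strict_mono[of j i]
      index_pos_strict_mono[of i k] index_pos_bounds[of j]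
    by (cases j i rule: linorder_cases; cases k i rule: linorder_cases)
      (auto simp: reduced_pos_def)
  have inj: "inj_on (reduced_pos i) (- {i})"
  proof (rule inj_onI)
    fix j k
    assume "j \<in> - {i}" "k \<in> - {i}" "reduced_pos i j = reduced_pos i k"
    then show "j = k" using less[of j k] less[of k j] by (cases j k rule: linorder_cases) auto
  qed
  moreover have "reduced_pos i ` (- {i}) \<subseteq> {1..CARD('n) - 1}"
  proof
    fix p assume "p \<in> reduced_pos i ` (- {i})"
    then obtain j where j: "j \<noteq> i" "p = reduced_pos i j" by auto
    show "p \<in> {1..CARD('n) - 1}"
      using j index_pos_strict_mono[of j i] index_pos_strict_mono[of i j]
        index_pos_bounds[of j] index_pos_bounds[of i]
      by (cases j i rule: linorder_cases) (auto simp: reduced_pos_def)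
  qed
  ultimately show ?thesis
    unfolding bij_betw_def
    by (intro conjI card_subset_eq) (auto simp: card_image Compl_eq_Diff_UNIV card_Diff_subset)
qed

lemma insert_slack_component:
  "insert_slack i z $ j =
    (if j = i then 1 - (\<Sum>k = 1..CARD('n) - 1. z k) else z (reduced_pos i j))"
  for i :: "'n::{finite,linorder}"
  by (simp add: insert_slack_def reduced_pos_def)

lemma sum_reduced_pos:
  fixes i :: "'n::{finite,linorder}"
  shows "(\<Sum>j\<in>- {i}. z (reduced_pos i j)) = (\<Sum>k = 1..CARD('n) - 1. z k)"
  by (rule sum.reindex_bij_betw[OF bij_betw_reduced_pos])

lemma sum_eq_slack: "(\<Sum>j\<in>UNIV. x j) = x i + (\<Sum>j\<in>- {i}. x j)"
  for i :: "'n::finite" and x :: "'n \<Rightarrow> real"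
  by (simp add: sum.remove[of UNIV i] Compl_eq_Diff_UNIV)

lemma sum_insert_slack: "(\<Sum>j\<in>UNIV. insert_slack i z $ j) = 1"
  for i :: "'n::{finite,linorder}"
proof -
  have "(\<Sum>j\<in>- {i}. insert_slack i z $ j) = (\<Sum>j\<in>- {i}. z (reduced_pos i j))"
    by (rule sum.cong) (auto simp: insert_slack_component)
  then show ?thesis
    by (simp add: sum_eq_slack[of _ i] sum_reduced_pos insert_slack_component)
qed

lemma eq_if_eq_off_slack:
  fixes x y :: "real ^ 'n"
  assumes "(\<Sum>j\<in>UNIV. x $ j) = (\<Sum>j\<in>UNIV. y $ j)" "\<And>j. j \<noteq> i \<Longrightarrow> x $ j = y $ j"
  shows "x = y"
proof -
  have "(\<Sum>j\<in>- {i}. x $ j) = (\<Sum>j\<in>- {i}. y $ j)"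
    using assms(2) by (intro sum.cong) auto
  then have "x $ i = y $ i" using assms(1) by (simp add: sum_eq_slack[of _ i])
  then show ?thesis using assms(2) by (metis vec_eq_iff)
qed

lemma insert_slack_surj:
  fixes x :: "real ^ 'n::{finite,linorder}"
  assumes "(\<Sum>j\<in>UNIV. x $ j) = 1"
  obtains z where "z \<in> Rn (CARD('n) - 1)" "insert_slack i z = x"
proof
  let ?g = "inv_into (- {i}) (reduced_pos i)"
  let ?z = "restrict (\<lambda>k. x $ ?g k) {1..CARD('n) - 1}"
  show "?z \<in> Rn (CARD('n) - 1)" by (simp add: Rn_def)
  show "insert_slack i ?z = x"
  proof (rule eq_if_eq_off_slack[of _ _ i])
    fix j assume "j \<noteq> i"
    then show "insert_slack i ?z $ j = x $ j"
      using bij_betw_reduced_pos[of i]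
      by (auto simp: insert_slack_component bij_betw_def inv_into_f_f)
  qed (simp add: assms sum_insert_slack)
qed

text \<open>Where the explicit \<open>\<infinity>\<close> branch of the reduced function is taken, the point with the slack
  coordinate inserted is off the simplex.\<close>

lemma Vbar_eq:
  fixes V :: "real ^ 'n::{finite,linorder} \<Rightarrow> ereal"
  assumes "regularization V"
  shows "Vbar V i z = V (insert_slack i z)"
proof (cases "(\<Sum>k = 1..CARD('n) - 1. z k) \<le> 1 \<and> (\<forall>k\<in>{1..CARD('n) - 1}. 0 \<le> z k)")
  case False
  have "insert_slack i z \<notin> prob_simplex"
  proof
    assume "insert_slack i z \<in> prob_simplex"
    then have nonneg: "0 \<le> insert_slack i z $ j" for j
      by (simp add: prob_simplex_def)
    have "0 \<le> z k" if "k \<in> {1..CARD('n) - 1}" for k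
    proof -
      have "k \<in> reduced_pos i ` (- {i})"
        using that by (simp only: bij_betw_imp_surj_on[OF bij_betw_reduced_pos])
      then obtain j where "j \<noteq> i" "k = reduced_pos i j" by blast
      then show ?thesis using nonneg[of j] by (simp add: insert_slack_component)
    qed
    moreover have "(\<Sum>k = 1..CARD('n) - 1. z k) \<le> 1"
      using nonneg[of i] by (simp add: insert_slack_component)
    ultimately show False using False by blast
  qed
  then have "V (insert_slack i z) = \<infinity>"
    using assms by (simp add: regularization_def)
  then show ?thesis using False by (auto simp: Vbar_def)
qed (simp add: Vbar_def)

lemma supermodular_Vbar_iff:
  fixes V :: "real ^ 'n::{finite,linorder} \<Rightarrow> ereal"
  assumes "regularization V"
  shows "supermodular_on (Rn (CARD('n) - 1)) (Vbar V i) \<longleftrightarrow> slack_supermodular V i"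
proof
  assume super: "supermodular_on (Rn (CARD('n) - 1)) (Vbar V i)"
  show "slack_supermodular V i"
    unfolding slack_supermodular_def
  proof (intro allI impI, elim conjE)
    fix x y u l :: "real ^ 'n::{finite,linorder}"
    assume sums: "(\<Sum>j\<in>UNIV. x $ j) = 1" "(\<Sum>j\<in>UNIV. y $ j) = 1"
        "(\<Sum>j\<in>UNIV. u $ j) = 1" "(\<Sum>j\<in>UNIV. l $ j) = 1"
      and ul: "\<forall>j. j \<noteq> i \<longrightarrow> u $ j = max (x $ j) (y $ j) \<and> l $ j = min (x $ j) (y $ j)"
    obtain z z' where z: "z \<in> Rn (CARD('n) - 1)" "insert_slack i z = x"
      and z': "z' \<in> Rn (CARD('n) - 1)" "insert_slack i z' = y"
      using insert_slack_surj sums by metis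
    have comp: "z (reduced_pos i j) = x $ j" "z' (reduced_pos i j) = y $ j" if "j \<noteq> i" for j
      using that z(2) z'(2) by (auto simp: insert_slack_component)
    have "insert_slack i (sup z z') = u"
      by (rule eq_if_eq_off_slack[of _ _ i])
        (use sums ul comp in \<open>simp_all add: sum_insert_slack,
          simp add: insert_slack_component sup_real_def\<close>)
    moreover have "insert_slack i (inf z z') = l"
      by (rule eq_if_eq_off_slack[of _ _ i])
        (use sums ul comp in \<open>simp_all add: sum_insert_slack,
          simp add: insert_slack_component inf_real_def\<close>)
    ultimately show "V x + V y \<le> V u + V l"
      using super z z' unfolding supermodular_on_def Vbar_eq[OF assms] by metis
  qed
next
  assume super: "slack_supermodular V i"
  show "supermodular_on (Rn (CARD('n) - 1)) (Vbar V i)"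
    unfolding supermodular_on_def Vbar_eq[OF assms]
  proof (intro ballI)
    fix z z' :: "nat \<Rightarrow> real"
    have "insert_slack i (sup z z') $ j = max (insert_slack i z $ j) (insert_slack i z' $ j) \<and>
        insert_slack i (inf z z') $ j = min (insert_slack i z $ j) (insert_slack i z' $ j)"
      if "j \<noteq> i" for j
      using that by (simp add: insert_slack_component sup_real_def inf_real_def)
    then show "V (insert_slack i z) + V (insert_slack i z')
        \<le> V (insert_slack i (sup z z')) + V (insert_slack i (inf z z'))"
      using super sum_insert_slack unfolding slack_supermodular_def by blast
  qed
qed

text \<open>Translation invariance allows the \<open>i\<close>-th coordinates of the two dual vectors to be
  normalised to \<open>0\<close>, so that the slack coordinate plays no role. The rest is the rearrangement
  inequality, coordinate by coordinate, and submodularity of \<open>w\<close>.\<close>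

lemma slack_supermodular_conjugate:
  fixes w :: "real ^ 'n \<Rightarrow> real"
  assumes trans: "\<And>\<mu> t. w (\<mu> + t *\<^sub>R vec 1) = w \<mu> + t"
    and sub: "submodular_on UNIV (\<lambda>\<mu>. ereal (w \<mu>))"
  shows "slack_supermodular (conjugate w) i"
  unfolding slack_supermodular_def
proof (intro allI impI, elim conjE)
  fix x y u l :: "real ^ 'n"
  assume sums: "(\<Sum>j\<in>UNIV. x $ j) = 1" "(\<Sum>j\<in>UNIV. y $ j) = 1"
      "(\<Sum>j\<in>UNIV. u $ j) = 1" "(\<Sum>j\<in>UNIV. l $ j) = 1"
    and ul: "\<forall>j. j \<noteq> i \<longrightarrow> u $ j = max (x $ j) (y $ j) \<and> l $ j = min (x $ j) (y $ j)"
  define N where "N \<mu> = \<mu> + (- (\<mu> $ i)) *\<^sub>R vec 1" for \<mu> :: "real ^ 'n"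
  have N_zero: "N \<mu> $ i = 0" for \<mu> by (simp add: N_def)
  have N_val: "N \<mu> \<bullet> v - w (N \<mu>) = \<mu> \<bullet> v - w \<mu>" if "(\<Sum>j\<in>UNIV. v $ j) = 1" for \<mu> v
    using that unfolding N_def trans by (simp add: inner_diff_left inner_one_vec)
  have key: "(\<mu> \<bullet> x - w \<mu>) + (\<nu> \<bullet> y - w \<nu>)
      \<le> (sup (N \<mu>) (N \<nu>) \<bullet> u - w (sup (N \<mu>) (N \<nu>))) + (inf (N \<mu>) (N \<nu>) \<bullet> l - w (inf (N \<mu>) (N \<nu>)))"
    for \<mu> \<nu>
  proof -
    let ?a = "N \<mu>" and ?b = "N \<nu>"
    have "?a \<bullet> x + ?b \<bullet> y \<le> sup ?a ?b \<bullet> u + inf ?a ?b \<bullet> l"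
      unfolding inner_vec_def sum.distrib[symmetric]
    proof (rule sum_mono)
      fix j
      have rearr: "a * s + b * t \<le> max a b * max s t + min a b * min s t" for a b s t :: real
      proof -
        have "0 \<le> (b - a) * (s - t)" if "a \<le> b" "t \<le> s"
          using that by simp
        moreover have "0 \<le> (a - b) * (t - s)" if "b \<le> a" "s \<le> t"
          using that by simp
        ultimately show ?thesis
          by (auto simp: max_def min_def algebra_simps)
      qed
      show "?a $ j \<bullet> x $ j + ?b $ j \<bullet> y $ j
          \<le> sup ?a ?b $ j \<bullet> u $ j + inf ?a ?b $ j \<bullet> l $ j"
        using ul rearr by (cases "j = i") (auto simp: N_zero)
    qed
    moreover have "w (sup ?a ?b) + w (inf ?a ?b) \<le> w ?a + w ?b"
      using sub by (simp add: submodular_on_real_iff)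
    ultimately show ?thesis
      using N_val[OF sums(1), of \<mu>] N_val[OF sums(2), of \<nu>] by linarith
  qed
  show "conjugate w x + conjugate w y \<le> conjugate w u + conjugate w l"
  proof (cases "conjugate w u = \<infinity> \<or> conjugate w l = \<infinity>")
    case False
    then obtain a b where ab: "conjugate w u = ereal a" "conjugate w l = ereal b"
      using conjugate_gt_minus_infinity[of w u] conjugate_gt_minus_infinity[of w l]
      by (cases "conjugate w u"; cases "conjugate w l") auto
    have bound: "(\<mu> \<bullet> x - w \<mu>) + (\<nu> \<bullet> y - w \<nu>) \<le> a + b" for \<mu> \<nu>
    proof -
      have "sup (N \<mu>) (N \<nu>) \<bullet> u - w (sup (N \<mu>) (N \<nu>)) \<le> a"
        and "inf (N \<mu>) (N \<nu>) \<bullet> l - w (inf (N \<mu>) (N \<nu>)) \<le> b"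
        using conjugate_ge[of _ u w] conjugate_ge[of _ l w] ab by (metis ereal_less_eq(3))+
      then show ?thesis using key[of \<mu> \<nu>] by linarith
    qed
    have y_le: "conjugate w y \<le> ereal (a + b - (\<mu> \<bullet> x - w \<mu>))" for \<mu>
      unfolding conjugate_def using bound[of \<mu>] by (intro SUP_least) (simp add: algebra_simps)
    then obtain c where c: "conjugate w y = ereal c"
      using conjugate_gt_minus_infinity[of w y] y_le[of 0] by (cases "conjugate w y") auto
    have "conjugate w x \<le> ereal (a + b - c)"
      unfolding conjugate_def using y_le c by (intro SUP_least) (simp add: algebra_simps)
    then show ?thesis using ab c by (cases "conjugate w x") auto
  next
    case True
    then have "conjugate w u + conjugate w l = \<infinity>"
      by auto
    then show ?thesis by (metis ereal_less_eq(1))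
  qed
qed

section \<open>Three alternatives\<close>

lemma argmax_representation_value:
  assumes rep: "argmax_representation q V" and V: "regularization V" "proper V"
  obtains c where "V (q \<mu>) = ereal c" "\<And>a v. V a = ereal v \<Longrightarrow> \<mu> \<bullet> a - v \<le> \<mu> \<bullet> q \<mu> - c"
proof -
  let ?f = "\<lambda>x. ereal (\<mu> \<bullet> x) - V x"
  have "is_arg_max ?f (\<lambda>x. x \<in> prob_simplex) (q \<mu>)"
    using rep unfolding argmax_representation_def by blast
  then have le: "?f y \<le> ?f (q \<mu>)" if "V y \<noteq> \<infinity>" for y
    using that V(1) unfolding is_arg_max_linorder regularization_def by blast
  have ninf: "V y \<noteq> - \<infinity>" for y
    using V(2) unfolding proper_def by (metis order_less_irrefl)
  obtain y v where "V y = ereal v"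
    using V(2) ninf unfolding proper_def by (metis ereal_cases order_less_irrefl)
  with le[of y] have "V (q \<mu>) \<noteq> \<infinity>" by auto
  with ninf obtain c where c: "V (q \<mu>) = ereal c" by (metis ereal_cases)
  show ?thesis
  proof (rule that[OF c])
    fix a v
    assume "V a = ereal v"
    then show "\<mu> \<bullet> a - v \<le> \<mu> \<bullet> q \<mu> - c" using le[of a] c by simp
  qed
qed

text \<open>With three alternatives, only two coordinates remain after removing the slack one.
  Recombine two points of the plane into \<open>a\<close>, with the larger first and the smaller second
  coordinate, and \<open>b\<close>, with the smaller first and the larger second. If the two points are
  comparable, they are the join and the meet of \<open>a\<close> and \<open>b\<close>, and supermodularity applies;
  otherwise they are \<open>a\<close> and \<open>b\<close> themselves.\<close>

lemma slack_supermodular_recombine: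
  fixes x y :: "real ^ 'n"
  assumes "CARD('n) = 3" and ijk: "i \<noteq> j" "i \<noteq> k" "j \<noteq> k"
    and super: "slack_supermodular V i"
    and sums: "(\<Sum>m\<in>UNIV. x $ m) = 1" "(\<Sum>m\<in>UNIV. y $ m) = 1"
  obtains a b where "a + b = x + y"
    "a $ j = max (x $ j) (y $ j)" "b $ k = max (x $ k) (y $ k)"
    "V a + V b \<le> V x + V y"
proof -
  have univ: "UNIV = {i, j, k}"
    by (rule card_subset_eq[symmetric]) (use assms(1) ijk in auto)
  have sum3: "(\<Sum>m\<in>UNIV. f m) = f i + f j + f k" for f :: "'n \<Rightarrow> real"
    using ijk by (simp add: univ)
  have other: "m = j \<or> m = k" if "m \<noteq> i" for m
    using univ that by blast
  have step: "V p + V r \<le> V u + V l"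
    if "(\<Sum>m\<in>UNIV. p $ m) = 1" "(\<Sum>m\<in>UNIV. r $ m) = 1"
      "(\<Sum>m\<in>UNIV. u $ m) = 1" "(\<Sum>m\<in>UNIV. l $ m) = 1"
      "u $ j = max (p $ j) (r $ j)" "u $ k = max (p $ k) (r $ k)"
      "l $ j = min (p $ j) (r $ j)" "l $ k = min (p $ k) (r $ k)" for p r u l
    using super that other unfolding slack_supermodular_def by blast
  define a where "a = (\<chi> m. if m = j then max (x $ j) (y $ j) else if m = k then min (x $ k) (y $ k)
    else 1 - max (x $ j) (y $ j) - min (x $ k) (y $ k))"
  define b where "b = (\<chi> m. if m = j then min (x $ j) (y $ j) else if m = k then max (x $ k) (y $ k)
    else 1 - min (x $ j) (y $ j) - max (x $ k) (y $ k))"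
  have a: "a $ j = max (x $ j) (y $ j)" "a $ k = min (x $ k) (y $ k)"
      "a $ i = 1 - max (x $ j) (y $ j) - min (x $ k) (y $ k)"
    and b: "b $ j = min (x $ j) (y $ j)" "b $ k = max (x $ k) (y $ k)"
      "b $ i = 1 - min (x $ j) (y $ j) - max (x $ k) (y $ k)"
    using ijk by (auto simp: a_def b_def)
  have sums_ab: "(\<Sum>m\<in>UNIV. a $ m) = 1" "(\<Sum>m\<in>UNIV. b $ m) = 1"
    by (simp_all add: sum3 a b)
  have eqI: "p = r"
    if "(\<Sum>m\<in>UNIV. p $ m) = 1" "(\<Sum>m\<in>UNIV. r $ m) = 1" "p $ j = r $ j" "p $ k = r $ k"
    for p r :: "real ^ 'n"
    using that other by (intro eq_if_eq_off_slack[of _ _ i]) auto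
  have "V a + V b \<le> V x + V y"
  proof -
    consider "x $ j \<le> y $ j" "x $ k \<le> y $ k" | "y $ j \<le> x $ j" "y $ k \<le> x $ k"
      | "x $ j \<le> y $ j" "y $ k \<le> x $ k" | "y $ j \<le> x $ j" "x $ k \<le> y $ k"
      by linarith
    then show ?thesis
    proof cases
      case 1
      then have "V a + V b \<le> V y + V x" using sums sums_ab a b by (intro step) auto
      then show ?thesis by (simp add: add.commute)
    next
      case 2
      then show ?thesis using sums sums_ab a b by (intro step) auto
    next
      case 3
      then have "a = y" "b = x" using sums sums_ab a b by (auto intro!: eqI)
      then show ?thesis by (simp add: add.commute)
    next
      case 4
      then have "a = x" "b = y" using sums sums_ab a b by (auto intro!: eqI)
      then show ?thesis by simp
    qed
  qed
  moreover have "a + b = x + y"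
  proof -
    have "(a + b) $ j = (x + y) $ j" "(a + b) $ k = (x + y) $ k" "(a + b) $ i = (x + y) $ i"
      using a b sums unfolding sum3 by (auto simp: max_def min_def)
    then have "(a + b) $ m = (x + y) $ m" for m
      using other[of m] by metis
    then show ?thesis by (simp add: vec_eq_iff)
  qed
  ultimately show ?thesis using that a(1) b(2) by blast
qed

lemma slack_supermodular_imp_substitutable_3:
  fixes q :: "real ^ 'n \<Rightarrow> real ^ 'n"
  assumes card: "CARD('n) = 3" and "choice_model q"
    and conv: "convex_on UNIV w" and grad: "\<And>\<mu>. GDERIV w \<mu> :> q \<mu>"
    and V: "regularization V" "proper V" "\<And>i. slack_supermodular V i"
    and rep: "argmax_representation q V"
    and "k \<noteq> j"
  shows "substitutable_to q k j"
  unfolding substitutable_to_iff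
proof (intro allI impI)
  fix \<mu> :: "real ^ 'n" and t :: real
  assume t: "0 \<le> t"
  let ?e = "axis j 1 :: real ^ 'n"
  define \<nu> where "\<nu> = \<mu> + t *\<^sub>R axis k 1"
  obtain i where i: "i \<noteq> j" "i \<noteq> k"
  proof -
    have "card {j, k} \<le> 2" by (simp add: card_insert_if)
    then have "{j, k} \<noteq> UNIV" using card by auto
    with that show ?thesis by blast
  qed
  have "\<forall>\<mu>. \<exists>c. V (q \<mu>) = ereal c \<and> (\<forall>a v. V a = ereal v \<longrightarrow> \<mu> \<bullet> a - v \<le> \<mu> \<bullet> q \<mu> - c)"
  proof
    fix \<mu>
    obtain c where "V (q \<mu>) = ereal c" "\<And>a v. V a = ereal v \<Longrightarrow> \<mu> \<bullet> a - v \<le> \<mu> \<bullet> q \<mu> - c"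
      using argmax_representation_value[OF rep V(1,2), of \<mu>] by blast
    then show "\<exists>c. V (q \<mu>) = ereal c \<and> (\<forall>a v. V a = ereal v \<longrightarrow> \<mu> \<bullet> a - v \<le> \<mu> \<bullet> q \<mu> - c)"
      by blast
  qed
  then obtain c where c: "\<And>\<mu>. V (q \<mu>) = ereal (c \<mu>)"
    and opt: "\<And>\<mu> a v. V a = ereal v \<Longrightarrow> \<mu> \<bullet> a - v \<le> \<mu> \<bullet> q \<mu> - c \<mu>"
    by (auto dest!: choice)
  \<comment> \<open>The conjugate of \<open>V\<close>, of which \<open>q\<close> is a subgradient selection.\<close>
  define v where "v \<mu> = \<mu> \<bullet> q \<mu> - c \<mu>" for \<mu>
  have v_sub: "v \<mu> + q \<mu> \<bullet> (\<nu> - \<mu>) \<le> v \<nu>" for \<mu> \<nu>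
    using opt[OF c[of \<mu>], of \<nu>] by (simp add: v_def inner_diff_right inner_commute)
  have decr: "v (\<nu> + s *\<^sub>R ?e) + v \<mu> \<le> v (\<mu> + s *\<^sub>R ?e) + v \<nu>" if s: "0 \<le> s" for s
  proof -
    define x y where "x = q (\<nu> + s *\<^sub>R ?e)" and "y = q \<mu>"
    have "(\<Sum>m\<in>UNIV. x $ m) = 1" "(\<Sum>m\<in>UNIV. y $ m) = 1"
      using assms(2) by (auto simp: choice_model_def x_def y_def prob_simplex_def image_subset_iff)
    then obtain a b where ab: "a + b = x + y"
      "a $ j = max (x $ j) (y $ j)" "b $ k = max (x $ k) (y $ k)" "V a + V b \<le> V x + V y"
      using slack_supermodular_recombine[OF card i \<open>k \<noteq> j\<close>[symmetric] V(3), of x y] by blast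
    have xy: "V x = ereal (c (\<nu> + s *\<^sub>R ?e))" "V y = ereal (c \<mu>)"
      by (simp_all add: x_def y_def c)
    have "V a \<noteq> - \<infinity>" "V b \<noteq> - \<infinity>"
      using V(2) unfolding proper_def by (metis order_less_irrefl)+
    with ab(4) xy obtain \<alpha> \<beta> where \<alpha>\<beta>: "V a = ereal \<alpha>" "V b = ereal \<beta>"
      by (cases "V a"; cases "V b") auto
    have "\<alpha> + \<beta> \<le> c (\<nu> + s *\<^sub>R ?e) + c \<mu>"
      using ab(4) xy \<alpha>\<beta> by simp
    moreover have "(\<mu> + s *\<^sub>R ?e) \<bullet> a - \<alpha> \<le> v (\<mu> + s *\<^sub>R ?e)" "\<nu> \<bullet> b - \<beta> \<le> v \<nu>"
      unfolding v_def by (rule opt[OF \<alpha>\<beta>(1)], rule opt[OF \<alpha>\<beta>(2)])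
    moreover have "(\<nu> + s *\<^sub>R ?e) \<bullet> x + \<mu> \<bullet> y \<le> (\<mu> + s *\<^sub>R ?e) \<bullet> a + \<nu> \<bullet> b"
    proof -
      have "\<mu> \<bullet> a + \<mu> \<bullet> b = \<mu> \<bullet> x + \<mu> \<bullet> y"
        using ab(1) by (simp flip: inner_add_right)
      moreover have "s * x $ j \<le> s * a $ j" "t * x $ k \<le> t * b $ k"
        using ab(2,3) s t by (auto intro!: mult_left_mono)
      ultimately show ?thesis
        by (simp add: \<nu>_def inner_add_left inner_axis inner_axis' algebra_simps)
    qed
    ultimately show ?thesis unfolding v_def[of "\<nu> + s *\<^sub>R ?e"] v_def[of \<mu>]
      by (simp add: x_def y_def)
  qed
  have le: "q \<nu> $ j \<le> q (\<mu> + s *\<^sub>R ?e) $ j" if s: "0 < s" for s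
  proof -
    have "s * q \<nu> $ j \<le> v (\<nu> + s *\<^sub>R ?e) - v \<nu>"
      using v_sub[of \<nu> "\<nu> + s *\<^sub>R ?e"] by (simp add: inner_axis)
    also have "\<dots> \<le> v (\<mu> + s *\<^sub>R ?e) - v \<mu>"
      using decr[of s] s by simp
    also have "\<dots> \<le> s * q (\<mu> + s *\<^sub>R ?e) $ j"
      using v_sub[of "\<mu> + s *\<^sub>R ?e" \<mu>] by (simp add: inner_axis)
    finally show ?thesis using s by simp
  qed
  \<comment> \<open>It remains to let \<open>s\<close> tend to 0. Continuity of \<open>q\<close> is avoided: by convexity, the slope
    of \<open>w\<close> at \<open>\<mu> + s e\<^sub>j\<close> is at most the difference quotient between \<open>s\<close> and \<open>2s\<close>, which
    is twice the quotient between \<open>0\<close> and \<open>2s\<close> minus that between \<open>0\<close> and \<open>s\<close>, and so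
    tends to the slope at \<open>\<mu>\<close>.\<close>
  let ?Q = "\<lambda>h s. (w (\<mu> + s *\<^sub>R h) - w \<mu>) / s"
  have "q \<nu> $ j \<le> (2 *\<^sub>R ?e) \<bullet> q \<mu> - ?e \<bullet> q \<mu>"
  proof (rule tendsto_lowerbound)
    show "((\<lambda>s. ?Q (2 *\<^sub>R ?e) s - ?Q ?e s) \<longlongrightarrow> (2 *\<^sub>R ?e) \<bullet> q \<mu> - ?e \<bullet> q \<mu>) (at_right 0)"
      by (intro tendsto_diff GDERIV_right_quotient grad)
    have "q \<nu> $ j \<le> ?Q (2 *\<^sub>R ?e) s - ?Q ?e s" if s: "0 < s" for s
    proof -
      have "w (\<mu> + s *\<^sub>R ?e) + s * q (\<mu> + s *\<^sub>R ?e) $ j \<le> w (\<mu> + s *\<^sub>R (2 *\<^sub>R ?e))"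
        using convex_GDERIV_above_tangent[OF conv grad, of "\<mu> + s *\<^sub>R ?e" "\<mu> + s *\<^sub>R (2 *\<^sub>R ?e)"]
        by (simp add: algebra_simps inner_axis)
      then have "q (\<mu> + s *\<^sub>R ?e) $ j \<le> ?Q (2 *\<^sub>R ?e) s - ?Q ?e s"
        using s by (simp add: field_simps)
      with le[OF s] show ?thesis by linarith
    qed
    then show "\<forall>\<^sub>F s in at_right 0. q \<nu> $ j \<le> ?Q (2 *\<^sub>R ?e) s - ?Q ?e s"
      by (intro eventually_at_rightI[of 0 1]) auto
  qed simp
  then show "q (\<mu> + t *\<^sub>R axis k 1) $ j \<le> q \<mu> $ j"
    by (simp add: \<nu>_def inner_axis')
qed

section \<open>Substitutability, submodular welfare and supermodular regularization\<close>

theorem theorem6: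
  fixes q :: "real ^ 'n::{finite,linorder} \<Rightarrow> real ^ 'n::{finite,linorder}"
    and w :: "real ^ 'n::{finite,linorder} \<Rightarrow> real"
  assumes "choice_model q"
    and "diff_choice_welfare w"
    and "\<And>\<mu>. GDERIV w \<mu> :> q \<mu>"
  shows "(substitutable_choice_model q \<longleftrightarrow> submodular_on UNIV (\<lambda>\<mu>. ereal (w \<mu>)))
    \<and> (substitutable_choice_model q \<longrightarrow>
        (\<exists>V. regularization V \<and> essentially_strictly_convex V \<and>
             (\<forall>i. supermodular_on (Rn (CARD('n) - 1)) (Vbar V i)) \<and>
             argmax_representation q V))
    \<and> (CARD('n) = 3 \<longrightarrow>
        (\<exists>V. regularization V \<and> essentially_strictly_convex V \<and>
             (\<forall>i. supermodular_on (Rn 2) (Vbar V i)) \<and>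
             argmax_representation q V) \<longrightarrow>
        substitutable_choice_model q)"
proof (intro conjI impI)
  have conv: "convex_on UNIV w" and trans: "\<And>\<mu> t. w (\<mu> + t *\<^sub>R vec 1) = w \<mu> + t"
    using assms(2) by (auto simp: diff_choice_welfare_def)
  show iff: "substitutable_choice_model q \<longleftrightarrow> submodular_on UNIV (\<lambda>\<mu>. ereal (w \<mu>))"
    using submodular_iff_gradient_antitone[OF assms(3)] assms(1)
    by (simp add: substitutable_choice_model_def)
  show "\<exists>V. regularization V \<and> essentially_strictly_convex V \<and>
      (\<forall>i. supermodular_on (Rn (CARD('n) - 1)) (Vbar V i)) \<and> argmax_representation q V"
    if "substitutable_choice_model q"
  proof (intro exI[of _ "conjugate w"] conjI allI)
    show reg: "regularization (conjugate w)"
      using conjugate_infinite_off_simplex[OF assms(2)] lower_semicontinuous_conjugate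
      by (auto simp: regularization_def)
    show "essentially_strictly_convex (conjugate w)"
      by (rule essentially_strictly_convex_conjugate[OF conv assms(3)])
    show "argmax_representation q (conjugate w)"
      by (rule argmax_representation_conjugate[OF assms(1) conv assms(3)])
    show "supermodular_on (Rn (CARD('n) - 1)) (Vbar (conjugate w) i)" for i
      unfolding supermodular_Vbar_iff[OF reg]
      using slack_supermodular_conjugate[OF trans] that iff by blast
  qed
  show "substitutable_choice_model q"
    if card: "CARD('n) = 3"
      and ex: "\<exists>V. regularization V \<and> essentially_strictly_convex V \<and>
        (\<forall>i. supermodular_on (Rn 2) (Vbar V i)) \<and> argmax_representation q V"
  proof -
    obtain V where V: "regularization V" "essentially_strictly_convex V"
        "\<And>i. supermodular_on (Rn (CARD('n) - 1)) (Vbar V i)" "argmax_representation q V"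
      using ex card by auto
    have "proper V" using V(2) by (simp add: essentially_strictly_convex_def)
    moreover have "slack_supermodular V i" for i
      using V(1,3) supermodular_Vbar_iff by blast
    ultimately show ?thesis
      using slack_supermodular_imp_substitutable_3[OF card assms(1) conv assms(3) V(1) _ _ V(4)]
        assms(1)
      by (simp add: substitutable_choice_model_def)
  qed
qed

end
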